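(* For every complex $q$ with $|q|<1$, $$\sum_{n,l=0}^\infty\frac{q^{n^2+l^2+nl}}{(q;q)_{n+l}(q;q)_n(q;q)_l}=\frac{1}{(q;q)_\infty}\prod_{\substack{m\ge1\\ m\not\equiv0,\pm2\ (\mathrm{mod}\ 5)}}\frac{1}{1-q^m}.$$
   Context: Notation: $(x;q)_n=\prod_{j=0}^{n-1}(1-xq^j)$ for integers $n\ge0$, and $(x;q)_\infty=\prod_{j\ge0}(1-xq^j)$. *)

theory Defs
  imports "HOL-Analysis.Analysis" "HOL-Number_Theory.Cong"
begin

definition qpoch :: "complex \<Rightarrow> complex \<Rightarrow> nat \<Rightarrow> complex" where
  "qpoch x q n = (\<Prod>j<n. 1 - x * q ^ j)"

definition qpoch_inf :: "complex \<Rightarrow> complex \<Rightarrow> complex" where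
  "qpoch_inf x q = (\<Prod>j. 1 - x * q ^ j)"

end

(* For fixed n, Cauchy's Durfee rectangle identity
     sum_l q^(l^2+nl) / ((q;q)_l (q;q)_(n+l)) = 1 / (q;q)_inf
   evaluates the sum over l, so the double sum is 1/(q;q)_inf times the first Rogers-Ramanujan sum
   sum_n q^(n^2) / (q;q)_n.  The q-Vandermonde formula gives the rectangle identity in the limit and
   is also the kernel of the Bailey transform.  Applying that transform twice to the unit Bailey pair
   and letting n tend to infinity expresses the Rogers-Ramanujan sum through
   sum_r (-1)^r q^(r(5r-1)/2), which the Jacobi triple product for the base q^5 turns into a product. *)

theory Submission
  imports Defs
begin

section \<open>Reciprocal q-factorials indexed by the integers\<close>

text \<open>The reciprocal of $(q;q)_m$, with the convention that it vanishes for $m < 0$. This makes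
  $(1 - q^m) c_m = c_{m-1}$ hold for all integers $m$ and lets sums run past their natural bounds.\<close>
definition qfac_inv :: "complex \<Rightarrow> int \<Rightarrow> complex" where
  "qfac_inv q m = (if m < 0 then 0 else 1 / qpoch q q (nat m))"

lemma one_minus_power_neq_0:
  fixes q :: complex
  assumes "norm q < 1" "m > 0"
  shows "1 - q ^ m \<noteq> 0"
proof
  assume "1 - q ^ m = 0"
  then have "norm q ^ m = 1" by (metis norm_one norm_power right_minus_eq)
  moreover have "norm q ^ m < 1" using assms by (simp add: power_less_one_iff)
  ultimately show False by simp
qed

lemma qpoch_neq_0:
  assumes "norm q < 1"
  shows "qpoch q q n \<noteq> 0"
  using one_minus_power_neq_0[OF assms, of "Suc _"] by (simp add: qpoch_def)

lemma qpoch_Suc: "qpoch q q (Suc n) = (1 - q ^ Suc n) * qpoch q q n"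
  by (simp add: qpoch_def mult.commute)

lemma qfac_inv_of_nat [simp]: "qfac_inv q (int n) = 1 / qpoch q q n"
  by (simp add: qfac_inv_def)

lemma qfac_inv_neg [simp]: "m < 0 \<Longrightarrow> qfac_inv q m = 0"
  by (simp add: qfac_inv_def)

lemma qfac_inv_0 [simp]: "qfac_inv q 0 = 1"
  by (simp add: qfac_inv_def qpoch_def)

lemma qfac_inv_rec:
  assumes "norm q < 1"
  shows "(1 - q powi m) * qfac_inv q m = qfac_inv q (m - 1)"
proof (cases "m \<le> 0")
  case True
  \<comment> \<open>At m = 0 the factor 1 - q^0 vanishes, in agreement with the value 0 at index
    -1.\<close>
  then show ?thesis by (cases "m = 0") auto
next
  case False
  then obtain n where n: "m = int (Suc n)"
    by (metis gr0_implies_Suc linorder_not_le zero_less_imp_eq_int)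
  then have n': "m - 1 = int n" by simp
  show ?thesis
    unfolding n' unfolding n qfac_inv_of_nat power_int_of_nat qpoch_Suc
    using one_minus_power_neq_0[OF assms, of "Suc n"] qpoch_neq_0[OF assms, of n]
    by simp
qed

section \<open>The q-Vandermonde formula\<close>

lemma sum_atMost_Suc_shift_0:
  fixes f :: "nat \<Rightarrow> 'a::comm_monoid_add"
  assumes "f 0 = 0"
  shows "(\<Sum>l\<le>Suc m. f l) = (\<Sum>l\<le>m. f (Suc l))"
  unfolding sum.atMost_Suc_shift assms by simp

text \<open>Splitting $1 - q^m = (1 - q^{m-l}) + q^{m-l} (1 - q^l)$ gives the recurrence
  $(1 - q^m) S_{m,a} = S_{m-1,a} + q^{m+a} S_{m-1,a+1}$ for the right-hand side.\<close>
lemma q_vandermonde: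
  fixes q :: complex and a :: int
  assumes q: "norm q < 1" "q \<noteq> 0"
  shows "qfac_inv q (int m) * qfac_inv q (int m + a) =
    (\<Sum>l\<le>m. q powi (int l * (int l + a)) * qfac_inv q (int m - int l) * qfac_inv q (int l)
             * qfac_inv q (int l + a))"
proof (induction m arbitrary: a)
  case 0
  then show ?case by simp
next
  case (Suc m)
  let ?c = "qfac_inv q"
  let ?t = "\<lambda>l. q powi (int l * (int l + a)) * ?c (int (Suc m) - int l) * ?c (int l) * ?c (int l + a)"
  have split: "(1 - q powi int (Suc m)) * ?t l =
      q powi (int l * (int l + a)) * ?c (int m - int l) * ?c (int l) * ?c (int l + a)
    + q powi (int (Suc m) - int l + int l * (int l + a)) * ?c (int (Suc m) - int l) * ?c (int l - 1) * ?c (int l + a)" for l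
  proof -
    have "q powi int (Suc m) = q powi (int (Suc m) - int l) * q powi int l"
      by (metis diff_add_cancel power_int_add q(2))
    then have *: "1 - q powi int (Suc m) =
       (1 - q powi (int (Suc m) - int l)) + q powi (int (Suc m) - int l) * (1 - q powi int l)"
      by (simp add: algebra_simps)
    have 1: "?c (int m - int l) = (1 - q powi (int (Suc m) - int l)) * ?c (int (Suc m) - int l)"
      using qfac_inv_rec[OF q(1), of "int (Suc m) - int l"] by simp
    show ?thesis
      unfolding * 1 qfac_inv_rec[OF q(1), of "int l", symmetric] power_int_add[OF disjI1, OF q(2)]
      by (simp only: algebra_simps)
  qed
  \<comment> \<open>The summand l = m + 1 contains the index -1 and vanishes, so this is the
    induction hypothesis for a.\<close>
  have A: "(\<Sum>l\<le>Suc m. q powi (int l * (int l + a)) * ?c (int m - int l) * ?c (int l) * ?c (int l + a))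
     = ?c (int m) * ?c (int m + a)"
    unfolding Suc.IH by simp
  have e: "int (Suc m) - int (Suc l) + int (Suc l) * (int (Suc l) + a)
      = (int (Suc m) + a) + int l * (int l + (a + 1))" for l
    by (simp add: algebra_simps)
  let ?v = "\<lambda>l. q powi (int (Suc m) - int l + int l * (int l + a)) * ?c (int (Suc m) - int l)
              * ?c (int l - 1) * ?c (int l + a)"
  have v: "?v (Suc l) = q powi (int (Suc m) + a) *
      (q powi (int l * (int l + (a + 1))) * ?c (int m - int l) * ?c (int l) * ?c (int l + (a + 1)))" for l
  proof -
    have s: "int (Suc m) - int (Suc l) = int m - int l" "int (Suc l) - 1 = int l"
      "int (Suc l) + a = int l + (a + 1)"
      by simp_all
    have "q powi (int (Suc m) - int (Suc l) + int (Suc l) * (int (Suc l) + a)) =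
        q powi (int (Suc m) + a) * q powi (int l * (int l + (a + 1)))"
      unfolding e by (rule power_int_add) (simp add: q)
    then show ?thesis
      by (simp only: s mult.assoc)
  qed
  \<comment> \<open>Here the summand l = 0 contains the index -1. Shifting l extracts q^(m+1+a) and
    leaves the induction hypothesis for a + 1.\<close>
  have B: "(\<Sum>l\<le>Suc m. ?v l) = q powi (int (Suc m) + a) * (?c (int m) * ?c (int m + (a + 1)))"
  proof -
    have "?v 0 = 0" by simp
    then have "(\<Sum>l\<le>Suc m. ?v l) = (\<Sum>l\<le>m. ?v (Suc l))"
      by (rule sum_atMost_Suc_shift_0)
    then show ?thesis
      unfolding v Suc.IH sum_distrib_left .
  qed
  have "(1 - q powi int (Suc m)) * (\<Sum>l\<le>Suc m. ?t l)
     = ?c (int m) * ?c (int m + a) + q powi (int (Suc m) + a) * (?c (int m) * ?c (int m + (a + 1)))"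
    unfolding sum_distrib_left split sum.distrib A B ..
  \<comment> \<open>With x = q^(m+1+a), both terms become multiples of
    \<open>?c (int (Suc m) + a)\<close>, with weights 1 - x and x that add up to 1.\<close>
  also have "?c (int m + a) = (1 - q powi (int (Suc m) + a)) * ?c (int (Suc m) + a)"
    by (subst qfac_inv_rec[OF q(1)]) (simp add: algebra_simps)
  also have "int m + (a + 1) = int (Suc m) + a" by simp
  also have "?c (int m) * ((1 - q powi (int (Suc m) + a)) * ?c (int (Suc m) + a)) +
      q powi (int (Suc m) + a) * (?c (int m) * ?c (int (Suc m) + a))
      = ?c (int m) * ?c (int (Suc m) + a)"
    by (simp only: algebra_simps mult_1_left)
  also have "?c (int m) = (1 - q powi int (Suc m)) * ?c (int (Suc m))"
    by (subst qfac_inv_rec[OF q(1)]) simp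
  finally have "(1 - q powi int (Suc m)) * (\<Sum>l\<le>Suc m. ?t l) =
     (1 - q powi int (Suc m)) * (?c (int (Suc m)) * ?c (int (Suc m) + a))"
    by (simp only: mult.assoc)
  moreover have "1 - q powi int (Suc m) \<noteq> 0"
    unfolding power_int_of_nat using one_minus_power_neq_0[OF q(1), of "Suc m"] by simp
  ultimately show ?case
    by (rule mult_left_cancel[THEN iffD1, OF _ sym, rotated])
qed

section \<open>The Bailey transform\<close>

text \<open>Both sides are even in r, so r = s with s a natural number suffices. For s > n both
  vanish; otherwise this is \<open>q_vandermonde\<close> with m = n - s and a = 2s, reindexed by k =
  l + s, because s^2 + l(l + 2s) = (l + s)^2. The terms with k < s are zero.\<close>

lemma bailey_kernel:
  fixes q :: complex and r :: int
  assumes q: "norm q < 1" "q \<noteq> 0"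
  shows "q powi (r\<^sup>2) * (qfac_inv q (int n - r) * qfac_inv q (int n + r)) =
    (\<Sum>k\<le>n. q ^ k\<^sup>2 * qfac_inv q (int n - int k) * (qfac_inv q (int k - r) * qfac_inv q (int k + r)))"
    (is "?L r = ?R r")
proof -
  have *: "?L (int s) = ?R (int s)" for s
  proof (cases "s \<le> n")
    case False
    then have "qfac_inv q (int k - int s) = 0" if "k \<le> n" for k using that by simp
    then show ?thesis using False by simp
  next
    case True
    have n: "int n - int s = int (n - s)" "int n + int s = int (n - s) + 2 * int s" using True by auto
    have e: "(int s)\<^sup>2 + int l * (int l + 2 * int s) = int ((l + s)\<^sup>2)" for l
      by (simp add: power2_eq_square algebra_simps)
    have "?L (int s) = (\<Sum>l\<le>n-s. q powi int ((l + s)\<^sup>2) * qfac_inv q (int (n - s) - int l) * qfac_inv q (int l)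
             * qfac_inv q (int l + 2 * int s))"
      unfolding n q_vandermonde[OF q] sum_distrib_left e[symmetric] power_int_add[OF disjI1, OF q(2)]
      by (simp only: mult.assoc)
    also have "\<dots> = (\<Sum>k\<in>{s..n}. q ^ k\<^sup>2 * qfac_inv q (int n - int k) * (qfac_inv q (int k - int s) * qfac_inv q (int k + int s)))"
    proof (rule sum.reindex_bij_witness[of _ "\<lambda>k. k - s" "\<lambda>l. l + s"], goal_cases)
      case (5 l)
      then have "int n - int (l + s) = int (n - s) - int l" "int (l + s) - int s = int l"
        "int (l + s) + int s = int l + 2 * int s"
        using True by auto
      then show ?case by (simp only: mult.assoc power_int_of_nat)
    qed (use True in auto)
    also have "\<dots> = ?R (int s)"
      by (rule sum.mono_neutral_left) auto
    finally show ?thesis .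
  qed
  show ?thesis
  proof (cases "r \<ge> 0")
    case True
    then show ?thesis using *[of "nat r"] by simp
  next
    case False
    then show ?thesis using *[of "nat (-r)"] by (simp add: mult.commute mult.left_commute)
  qed
qed

text \<open>Expand each term by \<open>bailey_kernel\<close> and interchange the sums. Read as a
  rule on Bailey pairs in symmetric bilateral form: multiplying \<alpha> by q^(r^2) replaces the
  inner sums over r by their weighted sum over k, so the rule can be iterated.\<close>

lemma bailey_lemma:
  fixes q :: complex and \<alpha> :: "int \<Rightarrow> complex"
  assumes q: "norm q < 1" "q \<noteq> 0"
  shows "(\<Sum>r\<in>{-int n..int n}. q powi (r\<^sup>2) * \<alpha> r * qfac_inv q (int n - r) * qfac_inv q (int n + r)) =
    (\<Sum>k\<le>n. q ^ k\<^sup>2 * qfac_inv q (int n - int k) *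
      (\<Sum>r\<in>{-int k..int k}. \<alpha> r * qfac_inv q (int k - r) * qfac_inv q (int k + r)))"
proof -
  have "(\<Sum>r\<in>{-int n..int n}. q powi (r\<^sup>2) * \<alpha> r * qfac_inv q (int n - r) * qfac_inv q (int n + r))
     = (\<Sum>r\<in>{-int n..int n}. \<alpha> r * (q powi (r\<^sup>2) * (qfac_inv q (int n - r) * qfac_inv q (int n + r))))"
    by (simp only: mult_ac)
  also have "\<dots> = (\<Sum>r\<in>{-int n..int n}. \<Sum>k\<le>n. q ^ k\<^sup>2 * qfac_inv q (int n - int k) *
      (\<alpha> r * qfac_inv q (int k - r) * qfac_inv q (int k + r)))"
    unfolding bailey_kernel[OF q] sum_distrib_left by (simp only: mult_ac)
  also have "\<dots> = (\<Sum>k\<le>n. q ^ k\<^sup>2 * qfac_inv q (int n - int k) *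
      (\<Sum>r\<in>{-int n..int n}. \<alpha> r * qfac_inv q (int k - r) * qfac_inv q (int k + r)))"
    by (subst sum.swap) (simp only: sum_distrib_left)
  also have "\<dots> = (\<Sum>k\<le>n. q ^ k\<^sup>2 * qfac_inv q (int n - int k) *
      (\<Sum>r\<in>{-int k..int k}. \<alpha> r * qfac_inv q (int k - r) * qfac_inv q (int k + r)))"
  proof (intro sum.cong refl)
    fix k assume "k \<in> {..n}"
    \<comment> \<open>For |r| > k one of the two indices k - r and k + r is negative, so the range
      of r shrinks to that of the smaller pair.\<close>
    have "(\<Sum>r\<in>{-int n..int n}. \<alpha> r * qfac_inv q (int k - r) * qfac_inv q (int k + r)) =
      (\<Sum>r\<in>{-int k..int k}. \<alpha> r * qfac_inv q (int k - r) * qfac_inv q (int k + r))"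
    proof (intro sum.mono_neutral_right ballI)
      fix r assume "r \<in> {- int n..int n} - {- int k..int k}"
      then have "int k - r < 0 \<or> int k + r < 0" by auto
      then show "\<alpha> r * qfac_inv q (int k - r) * qfac_inv q (int k + r) = 0" by auto
    qed (use \<open>k \<in> {..n}\<close> in auto)
    then show "q ^ k\<^sup>2 * qfac_inv q (int n - int k) *
        (\<Sum>r\<in>{-int n..int n}. \<alpha> r * qfac_inv q (int k - r) * qfac_inv q (int k + r)) =
      q ^ k\<^sup>2 * qfac_inv q (int n - int k) *
        (\<Sum>r\<in>{-int k..int k}. \<alpha> r * qfac_inv q (int k - r) * qfac_inv q (int k + r))"
      by simp
  qed
  finally show ?thesis .
qed

section \<open>The q-binomial theorem and the finite triple product\<close>

lemma triangular_Suc: "Suc k * (Suc k - 1) div 2 = k + k * (k - 1) div 2"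
  by (cases k) auto

text \<open>Writing $B_N(z)$ for the left-hand side, the splitting $1 - q^N = q^k (1 - q^{N-k}) + (1 - q^k)$
  gives $(1 - q^N) B_N(z) = (1 + z) B_{N-1}(qz)$.\<close>
lemma q_binomial:
  fixes q z :: complex
  assumes q: "norm q < 1"
  shows "(\<Sum>k\<le>N. z ^ k * q ^ (k * (k - 1) div 2) * qfac_inv q (int N - int k) * qfac_inv q (int k)) =
    qfac_inv q (int N) * (\<Prod>j<N. 1 + z * q ^ j)"
proof (induction N arbitrary: z)
  case 0
  then show ?case by simp
next
  case (Suc N)
  let ?c = "qfac_inv q"
  let ?t = "\<lambda>k. z ^ k * q ^ (k * (k - 1) div 2) * ?c (int (Suc N) - int k) * ?c (int k)"
  let ?u = "\<lambda>k. (z * q) ^ k * q ^ (k * (k - 1) div 2) * ?c (int N - int k) * ?c (int k)"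
  let ?v = "\<lambda>k. z ^ k * q ^ (k * (k - 1) div 2) * ?c (int (Suc N) - int k) * ?c (int k - 1)"
  have split: "(1 - q ^ Suc N) * ?t k = ?u k + ?v k" if "k \<le> Suc N" for k
  proof -
    have "q ^ Suc N = q ^ (Suc N - k) * q ^ k"
      using that by (simp flip: power_add)
    moreover have e: "q powi (int (Suc N) - int k) = q ^ (Suc N - k)"
      using that by (metis of_nat_diff power_int_of_nat)
    ultimately have *: "1 - q ^ Suc N = q ^ k * (1 - q powi (int (Suc N) - int k)) + (1 - q powi int k)"
      unfolding e by (simp add: algebra_simps)
    have 1: "?c (int N - int k) = (1 - q powi (int (Suc N) - int k)) * ?c (int (Suc N) - int k)"
      using qfac_inv_rec[OF q(1), of "int (Suc N) - int k"] by simp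
    show ?thesis
      unfolding * 1 qfac_inv_rec[OF q(1), of "int k", symmetric] power_mult_distrib
      by (simp only: algebra_simps)
  qed
  have U: "(\<Sum>k\<le>Suc N. ?u k) = ?c (int N) * (\<Prod>j<N. 1 + z * q * q ^ j)"
    unfolding Suc.IH[symmetric] by simp
  \<comment> \<open>The term k = 0 vanishes; in the others, shifting k yields an extra z q^k, which
    turns z^k into z (zq)^k.\<close>
  have V: "(\<Sum>k\<le>Suc N. ?v k) = z * (?c (int N) * (\<Prod>j<N. 1 + z * q * q ^ j))"
    unfolding Suc.IH[symmetric] sum.atMost_Suc_shift triangular_Suc power_add sum_distrib_left power_mult_distrib
    by (simp add: mult_ac del: qfac_inv_of_nat)
  have "(1 - q ^ Suc N) * (\<Sum>k\<le>Suc N. ?t k) = (\<Sum>k\<le>Suc N. ?u k) + (\<Sum>k\<le>Suc N. ?v k)"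
    unfolding sum_distrib_left sum.distrib[symmetric] by (rule sum.cong) (use split in auto)
  also have "\<dots> = ?c (int N) * ((1 + z) * (\<Prod>j<N. 1 + z * q * q ^ j))"
    unfolding U V by (simp only: distrib_left distrib_right mult_1_left mult_ac)
  also have "(1 + z) * (\<Prod>j<N. 1 + z * q * q ^ j) = (\<Prod>j<Suc N. 1 + z * q ^ j)"
    unfolding prod.lessThan_Suc_shift by (simp add: mult_ac)
  also have "?c (int N) = (1 - q ^ Suc N) * ?c (int (Suc N))"
    using qfac_inv_rec[OF q, of "int (Suc N)"] by (simp only: power_int_of_nat) simp
  finally have "(1 - q ^ Suc N) * (\<Sum>k\<le>Suc N. ?t k)
      = (1 - q ^ Suc N) * (?c (int (Suc N)) * (\<Prod>j<Suc N. 1 + z * q ^ j))"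
    by (simp only: mult.assoc)
  then show ?case
    by (rule mult_left_cancel[THEN iffD1, rotated]) (rule one_minus_power_neq_0[OF q zero_less_Suc])
qed

lemma triangular_pred: "(s - 1) * (s - 2) div 2 = s * (s - 1) div 2 - (s - 1)" for s :: int
proof -
  have "(s - 1) * (s - 2) = s * (s - 1) + (- (s - 1)) * 2" by (simp add: algebra_simps)
  then show ?thesis by (simp only: div_mult_self1)
qed

text \<open>Induction on $m$, with the case $m = 0$ given by the $q$-binomial theorem: the substitution
  $r = s - 1$ turns the sum for $(n, m + 1, z)$ into $q/z$ times the sum for $(n + 1, m, z/q)$.\<close>
lemma finite_jacobi_triple_product:
  fixes q z :: complex
  assumes q: "norm q < 1" "q \<noteq> 0" and "z \<noteq> 0"
  shows "(\<Sum>r\<in>{-int m..int n}. z powi r * q powi (r * (r - 1) div 2) * qfac_inv q (int n - r) * qfac_inv q (int m + r)) =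
    qfac_inv q (int n + int m) * (\<Prod>j<n. 1 + z * q ^ j) * (\<Prod>j<m. 1 + q ^ Suc j / z)"
  using \<open>z \<noteq> 0\<close>
proof (induction m arbitrary: n z)
  case 0
  have e: "int k * (int k - 1) div 2 = int (k * (k - 1) div 2)" for k
    by (cases k) (auto simp: zdiv_int algebra_simps)
  have "(\<Sum>r\<in>{-int 0..int n}. z powi r * q powi (r * (r - 1) div 2) * qfac_inv q (int n - r) * qfac_inv q (int 0 + r))
    = (\<Sum>k\<le>n. z ^ k * q ^ (k * (k - 1) div 2) * qfac_inv q (int n - int k) * qfac_inv q (int k))"
  proof (rule sum.reindex_bij_witness[of _ int nat], goal_cases)
    case (5 r)
    then obtain k where r: "r = int k" using nonneg_int_cases by auto
    show ?case unfolding r e by simp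
  qed auto
  then show ?case unfolding q_binomial[OF q(1)] by simp
next
  case (Suc m)
  let ?c = "qfac_inv q"
  have "(\<Sum>r\<in>{-int (Suc m)..int n}. z powi r * q powi (r * (r - 1) div 2) * ?c (int n - r) * ?c (int (Suc m) + r))
    = (\<Sum>s\<in>{-int m..int (Suc n)}. q / z * ((z / q) powi s * q powi (s * (s - 1) div 2) * ?c (int (Suc n) - s) * ?c (int m + s)))"
  proof (rule sum.reindex_bij_witness[of _ "\<lambda>s. s - 1" "\<lambda>r. r + 1"], goal_cases)
    case (5 r)
    have "q powi (r * (r - 1) div 2) = q powi ((r + 1) * (r + 1 - 1) div 2 - r)"
      using triangular_pred[of "r + 1"] by simp
    also have "\<dots> = q powi ((r + 1) * (r + 1 - 1) div 2) / q powi r"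
      using q by (simp add: power_int_diff)
    finally have *: "q powi (r * (r - 1) div 2) = q powi ((r + 1) * (r + 1 - 1) div 2) / q powi r" .
    have "z powi r = z powi (r + 1) / z" "q powi (r + 1) = q * q powi r"
      using Suc.prems q by (simp_all add: power_int_add)
    then show ?case unfolding * power_int_divide_distrib using q Suc.prems by (simp add: field_simps)
  qed auto
  also have "\<dots> = q / z * (?c (int (Suc n) + int m) * (\<Prod>j<Suc n. 1 + z / q * q ^ j) * (\<Prod>j<m. 1 + q ^ Suc j / (z / q)))"
    unfolding sum_distrib_left[symmetric] by (subst Suc.IH) (use Suc.prems q in auto)
  \<comment> \<open>The surplus factor 1 + z/q, combined with the prefactor q/z, becomes 1 + q/z,
    the factor j = 0 that the second product lacks.\<close>
  also have "(\<Prod>j<Suc n. 1 + z / q * q ^ j) = (1 + z / q) * (\<Prod>j<n. 1 + z * q ^ j)"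
    unfolding prod.lessThan_Suc_shift using q by simp
  also have "q / z * (?c (int (Suc n) + int m) * ((1 + z / q) * (\<Prod>j<n. 1 + z * q ^ j)) * (\<Prod>j<m. 1 + q ^ Suc j / (z / q)))
     = ?c (int (Suc n) + int m) * (\<Prod>j<n. 1 + z * q ^ j) * ((q / z * (1 + z / q)) * (\<Prod>j<m. 1 + q ^ Suc j / (z / q)))"
    by (simp only: mult_ac)
  also have "q / z * (1 + z / q) = 1 + q / z"
    using q Suc.prems by (simp add: field_simps)
  also have "(1 + q / z) * (\<Prod>j<m. 1 + q ^ Suc j / (z / q)) = (\<Prod>j<Suc m. 1 + q ^ Suc j / z)"
    unfolding prod.lessThan_Suc_shift by (simp add: mult_ac)
  finally show ?case by (simp add: algebra_simps)
qed

section \<open>Passage to the limit\<close>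

text \<open>Padding the triangular array with zeros gives full series dominated by C |f k|, so
  Tannery's theorem applies. As L does not depend on k, it factors out of the limit. In the
  applications g consists of values of \<open>qfac_inv\<close>.\<close>

lemma tannery_triangular:
  fixes f :: "nat \<Rightarrow> complex" and g :: "nat \<Rightarrow> nat \<Rightarrow> complex"
  assumes f: "summable (\<lambda>k. norm (f k))" and g: "\<And>n k. norm (g n k) \<le> C"
    and lim: "\<And>k. (\<lambda>n. g n k) \<longlonglongrightarrow> L"
  shows "(\<lambda>n. \<Sum>k\<le>n. f k * g n k) \<longlonglongrightarrow> suminf f * L"
proof -
  let ?a = "\<lambda>k n. if k \<le> n then f k * g n k else 0"
  have C: "0 \<le> C" using g[of 0 0] norm_ge_zero order_trans by blast
  have "(\<lambda>n. suminf (\<lambda>k. ?a k n)) \<longlonglongrightarrow> suminf (\<lambda>k. f k * L)"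
  proof (rule tannerys_theorem[where M = "\<lambda>k. norm (f k) * C", THEN conjunct2, THEN conjunct2])
    fix k
    have "(\<lambda>n. f k * g n k) \<longlonglongrightarrow> f k * L"
      by (intro tendsto_intros lim)
    then show "(\<lambda>n. ?a k n) \<longlonglongrightarrow> f k * L"
      by (rule Lim_transform_eventually) (use eventually_ge_at_top[of k] in \<open>eventually_elim, auto\<close>)
  next
    show "\<forall>\<^sub>F (k, n) in at_top \<times>\<^sub>F sequentially. norm (?a k n) \<le> norm (f k) * C"
      using g C by (intro always_eventually) (auto simp: norm_mult intro!: mult_left_mono)
  qed (use f in \<open>auto intro: summable_mult2\<close>)
  moreover have "suminf (\<lambda>k. ?a k n) = (\<Sum>k\<le>n. f k * g n k)" for n
    by (subst suminf_finite[of "{..n}"]) auto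
  moreover have "suminf (\<lambda>k. f k * L) = suminf f * L"
    by (rule suminf_mult2[OF summable_norm_cancel[OF f], symmetric])
  ultimately show ?thesis by simp
qed

lemma convergent_prod_qpoch_inf:
  assumes "norm q < 1"
  shows "convergent_prod (\<lambda>j. 1 - q * q ^ j :: complex)"
proof -
  have "summable (\<lambda>j. norm q * norm q ^ j)"
    using assms by (intro summable_mult summable_geometric) auto
  then show ?thesis
    by (intro abs_convergent_prod_imp_convergent_prod summable_imp_abs_convergent_prod)
       (simp add: norm_mult norm_power)
qed

lemma qpoch_tendsto:
  assumes "norm q < 1"
  shows "qpoch q q \<longlonglongrightarrow> qpoch_inf q q"
  using convergent_prod_LIMSEQ[OF convergent_prod_qpoch_inf[OF assms]]
  unfolding qpoch_inf_def qpoch_def[abs_def] LIMSEQ_lessThan_iff_atMost .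

lemma qpoch_inf_neq_0:
  assumes "norm q < 1"
  shows "qpoch_inf q q \<noteq> 0"
  unfolding qpoch_inf_def
proof (rule prodinf_nonzero[OF convergent_prod_qpoch_inf[OF assms]])
  show "1 - q * q ^ i \<noteq> 0" for i
    using one_minus_power_neq_0[OF assms, of "Suc i"] by simp
qed

lemma qfac_inv_tendsto:
  assumes "norm q < 1" and "filterlim h at_top sequentially"
  shows "(\<lambda>n. qfac_inv q (h n)) \<longlonglongrightarrow> 1 / qpoch_inf q q"
proof -
  have "filterlim (\<lambda>n. nat (h n)) at_top sequentially"
    using filterlim_compose[OF filterlim_nat_sequentially assms(2)] .
  then have "(\<lambda>n. 1 / qpoch q q (nat (h n))) \<longlonglongrightarrow> 1 / qpoch_inf q q"
    by (intro tendsto_divide tendsto_const filterlim_compose[OF qpoch_tendsto[OF assms(1)]]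
        qpoch_inf_neq_0 assms)
  moreover have "\<forall>\<^sub>F n in sequentially. h n \<ge> 0"
    using assms(2) by (simp add: filterlim_at_top)
  ultimately show ?thesis
    by (elim Lim_transform_eventually eventually_mono) (simp add: qfac_inv_def)
qed

lemma filterlim_int_add: "filterlim (\<lambda>n. int n + r) at_top sequentially"
proof (unfold filterlim_at_top, intro allI)
  fix Z show "\<forall>\<^sub>F n in sequentially. Z \<le> int n + r"
    using eventually_ge_at_top[of "nat (Z - r)"] by eventually_elim auto
qed

text \<open>A convergent sequence is bounded, and negative indices contribute 0. The bound supplies
  the constant for Tannery's theorem.\<close>

lemma qfac_inv_bounded:
  assumes "norm q < 1"
  obtains C where "C > 0" "\<And>m. norm (qfac_inv q m) \<le> C"
proof -
  have "convergent (\<lambda>n. 1 / qpoch q q n)"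
    using qfac_inv_tendsto[OF assms filterlim_int_add[of 0]] by (auto simp: convergent_def)
  then obtain C where C: "C > 0" "\<And>n. norm (1 / qpoch q q n) \<le> C"
    by (metis convergent_imp_Bseq BseqE)
  then have "norm (qfac_inv q m) \<le> C" for m
    by (auto simp: qfac_inv_def less_imp_le)
  with C(1) show ?thesis using that by blast
qed

lemma summable_norm_power_mono:
  fixes q :: complex and e :: "nat \<Rightarrow> nat"
  assumes "norm q < 1" "\<And>k. k \<le> e k" "\<And>k. norm (b k) \<le> B"
  shows "summable (\<lambda>k. norm (q ^ e k * b k))"
proof (rule summable_comparison_test')
  show "summable (\<lambda>k. norm q ^ k * B)"
    using assms(1) by (intro summable_mult2 summable_geometric) auto
  show "norm (norm (q ^ e k * b k)) \<le> norm q ^ k * B" for k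
    using assms by (auto simp: norm_mult norm_power intro!: mult_mono power_decreasing)
qed

section \<open>Cauchy's Durfee rectangle identity\<close>

text \<open>Let m tend to infinity in \<open>q_vandermonde\<close> with a = n. With P = (q;q)_inf,
  the product side tends to 1/P^2 and the sum side to the series times 1/P; one factor 1/P
  cancels.\<close>

lemma cauchy_durfee_rectangle:
  fixes q :: complex
  assumes q: "norm q < 1" "q \<noteq> 0"
  defines "f \<equiv> \<lambda>n l. q ^ (l * (l + n)) * (qfac_inv q (int l) * qfac_inv q (int l + int n))"
  shows "summable (\<lambda>l. norm (f n l))" "f n sums (1 / qpoch_inf q q)"
proof -
  obtain C where C: "C > 0" "\<And>m. norm (qfac_inv q m) \<le> C"
    using qfac_inv_bounded[OF q(1)] by blast
  show summ: "summable (\<lambda>l. norm (f n l))"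
    unfolding f_def
  proof (rule summable_norm_power_mono[where B = "C * C"])
    show "norm (qfac_inv q (int k) * qfac_inv q (int k + int n)) \<le> C * C" for k
      unfolding norm_mult by (intro mult_mono C(2) norm_ge_zero order_less_imp_le[OF C(1)])
    show "k \<le> k * (k + n)" for k by (cases k) auto
  qed fact
  have "(\<lambda>m. \<Sum>l\<le>m. f n l * qfac_inv q (int m + (- int l))) \<longlonglongrightarrow> suminf (f n) * (1 / qpoch_inf q q)"
    by (rule tannery_triangular[OF summ C(2)]) (intro qfac_inv_tendsto filterlim_int_add q)
  \<comment> \<open>The indices are written as \<open>int m + r\<close>, even for r = 0, to fit
    \<open>filterlim_int_add\<close>.\<close>
  moreover have "(\<Sum>l\<le>m. f n l * qfac_inv q (int m + (- int l))) = qfac_inv q (int m + 0) * qfac_inv q (int m + int n)" for m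
  proof -
    have "qfac_inv q (int m + 0) * qfac_inv q (int m + int n) = qfac_inv q (int m) * qfac_inv q (int m + int n)"
      by simp
    also have "\<dots> = (\<Sum>l\<le>m. f n l * qfac_inv q (int m + (- int l)))"
    proof -
      have e: "q powi (int l * (int l + int n)) = q ^ (l * (l + n))" for l
        by (metis of_nat_add of_nat_mult power_int_of_nat)
      show ?thesis
        by (subst q_vandermonde[OF q]) (simp only: e f_def mult_ac diff_conv_add_uminus)
    qed
    finally show ?thesis ..
  qed
  moreover have "(\<lambda>m. qfac_inv q (int m + 0) * qfac_inv q (int m + int n)) \<longlonglongrightarrow> 1 / qpoch_inf q q * (1 / qpoch_inf q q)"
    by (intro tendsto_mult qfac_inv_tendsto filterlim_int_add q)
  ultimately have "suminf (f n) * (1 / qpoch_inf q q) = 1 / qpoch_inf q q * (1 / qpoch_inf q q)"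
    using LIMSEQ_unique by fastforce
  then have "suminf (f n) = 1 / qpoch_inf q q"
    by (rule mult_right_cancel[THEN iffD1, rotated]) (simp add: qpoch_inf_neq_0 q)
  then show "f n sums (1 / qpoch_inf q q)"
    using summable_sums[OF summable_norm_cancel[OF summ]] by simp
qed

section \<open>Bilateral sums and the theta series\<close>

text \<open>Pairing r = k with r = -k makes the symmetric partial sums of a bilateral series the
  ordinary partial sums of a one-sided one. The case k = 0 keeps the central term from being counted
  twice.\<close>

definition fold_symmetric :: "(int \<Rightarrow> complex) \<Rightarrow> nat \<Rightarrow> complex" where
  "fold_symmetric \<alpha> k = (if k = 0 then \<alpha> 0 else \<alpha> (int k) + \<alpha> (- int k))"

lemma sum_symmetric_interval: "(\<Sum>r\<in>{-int n..int n}. \<alpha> r) = (\<Sum>k\<le>n. fold_symmetric \<alpha> k)"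
proof (induction n)
  case 0
  then show ?case by (simp add: fold_symmetric_def)
next
  case (Suc n)
  have *: "{-int (Suc n)..int (Suc n)} = insert (int (Suc n)) (insert (- int (Suc n)) {-int n..int n})"
    by auto
  show ?case
    unfolding * using Suc by (simp add: fold_symmetric_def)
qed

text \<open>The weight is even in r, so it comes out of the folding and Tannery's theorem applies;
  each of its two factors tends to 1/(q;q)_inf.\<close>

lemma bilateral_bailey_limit:
  assumes q: "norm q < 1" and summ: "summable (\<lambda>k. norm (fold_symmetric \<alpha> k))"
  shows "(\<lambda>n. \<Sum>r\<in>{-int n..int n}. \<alpha> r * qfac_inv q (int n - r) * qfac_inv q (int n + r))
    \<longlonglongrightarrow> suminf (fold_symmetric \<alpha>) * (1 / qpoch_inf q q * (1 / qpoch_inf q q))"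
proof -
  obtain C where C: "C > 0" "\<And>m. norm (qfac_inv q m) \<le> C"
    using qfac_inv_bounded[OF q(1)] by blast
  have "(\<lambda>n. \<Sum>k\<le>n. fold_symmetric \<alpha> k * (qfac_inv q (int n + (- int k)) * qfac_inv q (int n + int k)))
    \<longlonglongrightarrow> suminf (fold_symmetric \<alpha>) * (1 / qpoch_inf q q * (1 / qpoch_inf q q))"
  proof (rule tannery_triangular[OF summ])
    show "norm (qfac_inv q (int n + (- int k)) * qfac_inv q (int n + int k)) \<le> C * C" for n k
      unfolding norm_mult by (intro mult_mono C(2) norm_ge_zero order_less_imp_le[OF C(1)])
  qed (intro tendsto_mult qfac_inv_tendsto filterlim_int_add q)
  moreover have "fold_symmetric \<alpha> k * (qfac_inv q (int n + (- int k)) * qfac_inv q (int n + int k))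
      = fold_symmetric (\<lambda>r. \<alpha> r * qfac_inv q (int n - r) * qfac_inv q (int n + r)) k" for n k
    by (simp add: fold_symmetric_def algebra_simps)
  ultimately show ?thesis unfolding sum_symmetric_interval by simp
qed

text \<open>The coefficient $(-1)^r q^{r(5r-1)/2}$, written as the unit Bailey pair after two steps of the
  Bailey lemma.\<close>
definition theta_coeff :: "complex \<Rightarrow> int \<Rightarrow> complex" where
  "theta_coeff q r = q powi r\<^sup>2 * (q powi r\<^sup>2 * ((-1) powi r * q powi (r * (r - 1) div 2)))"

text \<open>With t = r(r-1)/2 the exponent is 2r^2 + t = 2r + 5t. This is the shape of the triple
  product with base q^5 and z = -q^2.\<close>

lemma theta_coeff_alt:
  assumes "q \<noteq> 0"
  shows "theta_coeff q r = (- (q\<^sup>2)) powi r * (q ^ 5) powi (r * (r - 1) div 2)"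
proof -
  define t where "t = r * (r - 1) div 2"
  have t: "2 * t = r * (r - 1)" unfolding t_def by simp
  have "(- (q\<^sup>2)) powi r = ((-1) * q\<^sup>2) powi r" by simp
  also have "\<dots> = (-1) powi r * q powi (2 * r)"
    unfolding power_int_mult_distrib power_int_power by simp
  finally have 1: "(- (q\<^sup>2)) powi r = (-1) powi r * q powi (2 * r)" .
  have 2: "(q ^ 5) powi t = q powi (5 * t)" by (simp add: power_int_power)
  have e: "r\<^sup>2 + (r\<^sup>2 + t) = 2 * r + 5 * t"
    using t by (simp add: power2_eq_square algebra_simps)
  have "theta_coeff q r = (-1) powi r * q powi (r\<^sup>2 + (r\<^sup>2 + t))"
    unfolding theta_coeff_def t_def[symmetric] power_int_add[OF disjI1, OF assms] by simp
  then show ?thesis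
    unfolding e 1 t_def[symmetric] 2 power_int_add[OF disjI1, OF assms] by simp
qed

lemma norm_theta_coeff_le:
  assumes "norm q < 1" "q \<noteq> 0"
  shows "norm (theta_coeff q r) \<le> norm q ^ nat \<bar>r\<bar>"
proof -
  define t where "t = r * (r - 1) div 2"
  have t: "2 * t = r * (r - 1)" unfolding t_def by simp
  have t0: "t \<ge> 0"
  proof -
    have "r * (r - 1) \<ge> 0" by (cases "r \<ge> 1") (auto intro: mult_nonpos_nonpos)
    then show ?thesis using t by linarith
  qed
  have r2: "\<bar>r\<bar> \<le> r\<^sup>2"
  proof (cases "r = 0")
    case False
    then have "\<bar>r\<bar> * 1 \<le> \<bar>r\<bar> * \<bar>r\<bar>"
      by (intro mult_left_mono) auto
    then show ?thesis by (simp add: power2_eq_square)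
  qed simp
  have nz: "norm q \<noteq> 0" using assms(2) by simp
  have "norm (theta_coeff q r) = norm q powi (r\<^sup>2 + (r\<^sup>2 + t))"
    unfolding theta_coeff_def t_def[symmetric] power_int_add[OF disjI1, OF nz] norm_mult norm_power_int
    by simp
  also have "\<dots> = norm q ^ nat (r\<^sup>2 + (r\<^sup>2 + t))"
    using t0 by (simp add: power_int_nonneg_exp)
  also have "\<dots> \<le> norm q ^ nat \<bar>r\<bar>"
    using assms t0 r2 by (intro power_decreasing nat_mono) auto
  finally show ?thesis .
qed

lemma summable_theta_coeff:
  assumes "norm q < 1" "q \<noteq> 0"
  shows "summable (\<lambda>k. norm (fold_symmetric (theta_coeff q) k))"
proof (rule summable_comparison_test')
  show "summable (\<lambda>k. 2 * norm q ^ k)"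
    using assms(1) by (intro summable_mult summable_geometric) auto
  show "norm (norm (fold_symmetric (theta_coeff q) k)) \<le> 2 * norm q ^ k" for k
  proof (cases "k = 0")
    case True
    then show ?thesis using norm_theta_coeff_le[OF assms, of 0] by (simp add: fold_symmetric_def)
  next
    case False
    have "norm (theta_coeff q (int k) + theta_coeff q (- int k)) \<le> norm q ^ k + norm q ^ k"
      using norm_theta_coeff_le[OF assms, of "int k"] norm_theta_coeff_le[OF assms, of "- int k"]
      by (intro norm_triangle_mono) auto
    then show ?thesis using False by (simp add: fold_symmetric_def)
  qed
qed

section \<open>Two Bailey steps from the unit pair\<close>

text \<open>Put z = -1 and m = n in the finite triple product: for n > 0 the factor j = 0 is 1 + z =
  0.\<close>

lemma unit_bailey_pair:
  fixes q :: complex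
  assumes q: "norm q < 1" "q \<noteq> 0"
  shows "(\<Sum>r\<in>{-int n..int n}. (-1) powi r * q powi (r * (r - 1) div 2) * qfac_inv q (int n - r) * qfac_inv q (int n + r))
    = (if n = 0 then 1 else 0)"
proof (cases n)
  case (Suc n')
  have "(\<Prod>j<n. 1 + (-1) * q ^ j) = 0"
    by (rule prod_zero) (use Suc in \<open>auto intro: bexI[of _ 0]\<close>)
  then show ?thesis using Suc by (subst finite_jacobi_triple_product[OF q]) auto
qed simp

lemma bressoud_identity:
  fixes q :: complex
  assumes q: "norm q < 1" "q \<noteq> 0"
  shows "(\<Sum>r\<in>{-int n..int n}. theta_coeff q r * qfac_inv q (int n - r) * qfac_inv q (int n + r))
    = (\<Sum>k\<le>n. q ^ k\<^sup>2 * qfac_inv q (int n - int k) * qfac_inv q (int k))"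
proof -
  have "(\<Sum>r\<in>{-int k..int k}. q powi r\<^sup>2 * ((-1) powi r * q powi (r * (r - 1) div 2)) * qfac_inv q (int k - r) * qfac_inv q (int k + r))
    = qfac_inv q (int k)" for k
  proof -
    \<comment> \<open>In the first Bailey step the unit pair leaves only j = 0, so the new inner sum
      is \<open>qfac_inv q (int k)\<close>. The second step then gives the claim.\<close>
    have "(\<Sum>j\<le>k. q ^ j\<^sup>2 * qfac_inv q (int k - int j) * (if j = 0 then 1 else 0)) =
       (\<Sum>j\<in>{0}. q ^ j\<^sup>2 * qfac_inv q (int k - int j) * (if j = 0 then 1 else 0))"
      by (rule sum.mono_neutral_right) auto
    then show ?thesis
      unfolding bailey_lemma[OF q] unit_bailey_pair[OF q] by simp
  qed
  then show ?thesis
    unfolding theta_coeff_def bailey_lemma[OF q] by simp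
qed

text \<open>Let n tend to infinity in \<open>bressoud_identity\<close>: with P = (q;q)_inf, one side
  tends to the theta series over P^2, the other to the Rogers-Ramanujan sum over P.\<close>

lemma rogers_ramanujan_theta:
  fixes q :: complex
  assumes q: "norm q < 1" "q \<noteq> 0"
  shows "suminf (fold_symmetric (theta_coeff q)) = qpoch_inf q q * (\<Sum>k. q ^ k\<^sup>2 * qfac_inv q (int k))"
proof -
  let ?f = "\<lambda>k. q ^ k\<^sup>2 * qfac_inv q (int k)"
  obtain C where C: "C > 0" "\<And>m. norm (qfac_inv q m) \<le> C"
    using qfac_inv_bounded[OF q(1)] by blast
  have summ: "summable (\<lambda>k. norm (?f k))"
    by (rule summable_norm_power_mono[OF q(1) _ C(2)]) (simp add: power2_nat_le_imp_le)
  have "(\<lambda>n. \<Sum>k\<le>n. ?f k * qfac_inv q (int n + (- int k))) \<longlonglongrightarrow> suminf ?f * (1 / qpoch_inf q q)"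
    by (rule tannery_triangular[OF summ C(2)]) (intro qfac_inv_tendsto filterlim_int_add q)
  moreover have "(\<Sum>k\<le>n. ?f k * qfac_inv q (int n + (- int k))) =
    (\<Sum>r\<in>{-int n..int n}. theta_coeff q r * qfac_inv q (int n - r) * qfac_inv q (int n + r))" for n
    unfolding bressoud_identity[OF q] by (simp add: mult_ac)
  ultimately have "suminf (fold_symmetric (theta_coeff q)) * (1 / qpoch_inf q q * (1 / qpoch_inf q q))
     = suminf ?f * (1 / qpoch_inf q q)"
    using LIMSEQ_unique bilateral_bailey_limit[OF q(1) summable_theta_coeff[OF q]] by fastforce
  then show ?thesis using qpoch_inf_neq_0[OF q(1)] by (simp add: field_simps)
qed

section \<open>The theta series as a product and the Rogers-Ramanujan identity\<close>

lemma theta_product_limit: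
  fixes q :: complex
  assumes q: "norm q < 1" "q \<noteq> 0"
  shows "(\<lambda>n. (\<Prod>j<n. (1 - q ^ (5 * j + 2)) * (1 - q ^ (5 * j + 3)) * (1 - q ^ (5 * j + 5))))
    \<longlonglongrightarrow> suminf (fold_symmetric (theta_coeff q))"
proof -
  define p where "p = q ^ 5"
  have p: "norm p < 1" "p \<noteq> 0"
    using q by (auto simp: p_def norm_power power_less_one_iff)
  let ?P = "qpoch_inf p p" and ?S = "suminf (fold_symmetric (theta_coeff q))"
  let ?u = "\<lambda>n. (\<Prod>j<n. 1 + - (q\<^sup>2) * p ^ j) * (\<Prod>j<n. 1 + p ^ Suc j / - (q\<^sup>2))"
  have "(\<Sum>r\<in>{-int n..int n}. theta_coeff q r * qfac_inv p (int n - r) * qfac_inv p (int n + r))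
      = qfac_inv p (int n + int n) * ?u n" for n
    unfolding theta_coeff_alt[OF q(2)] p_def[symmetric]
    by (subst finite_jacobi_triple_product[OF p]) (use q in \<open>auto simp: mult.assoc\<close>)
  \<comment> \<open>The limit lemma is used with weights in base p = q^5, while the coefficients
    still come from q.\<close>
  then have lim: "(\<lambda>n. qfac_inv p (int n + int n) * ?u n) \<longlonglongrightarrow> ?S * (1 / ?P * (1 / ?P))"
    using bilateral_bailey_limit[OF p(1) summable_theta_coeff[OF q]] by simp
  have dbl: "filterlim (\<lambda>n. int n + int n) at_top sequentially"
  proof (unfold filterlim_at_top, intro allI)
    fix Z show "\<forall>\<^sub>F n in sequentially. Z \<le> int n + int n"
      using eventually_ge_at_top[of "nat Z"] by eventually_elim auto
  qed
  \<comment> \<open>Dividing by \<open>qfac_inv p (2n)\<close> and multiplying by (p;p)_n removes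
    both factors 1/P from the limit; (p;p)_n also supplies the exponents 5j + 5.\<close>
  have "(\<lambda>n. qfac_inv p (int n + int n) * ?u n / qfac_inv p (int n + int n) * qpoch p p n)
      \<longlonglongrightarrow> ?S * (1 / ?P * (1 / ?P)) / (1 / ?P) * ?P"
    by (intro tendsto_intros lim qfac_inv_tendsto dbl p qpoch_tendsto)
       (use qpoch_inf_neq_0[OF p(1)] in auto)
  moreover have "?S * (1 / ?P * (1 / ?P)) / (1 / ?P) * ?P = ?S"
    using qpoch_inf_neq_0[OF p(1)] by simp
  moreover have "qfac_inv p (int n + int n) * ?u n / qfac_inv p (int n + int n) * qpoch p p n =
     (\<Prod>j<n. (1 - q ^ (5 * j + 2)) * (1 - q ^ (5 * j + 3)) * (1 - q ^ (5 * j + 5)))" for n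
  proof -
    have "qfac_inv p (int n + int n) \<noteq> 0"
      using qpoch_neq_0[OF p(1)] by (simp flip: of_nat_add)
    moreover have "1 + - (q\<^sup>2) * p ^ j = 1 - q ^ (5 * j + 2)" for j
      by (simp add: p_def power_add power2_eq_square flip: power_mult)
    moreover have "1 + p ^ Suc j / - (q\<^sup>2) = 1 - q ^ (5 * j + 3)" for j
    proof -
      have "p ^ Suc j = q ^ (5 * j + 3) * q\<^sup>2"
        unfolding p_def power_mult[symmetric] power_add[symmetric] by (rule arg_cong[of _ _ "(^) q"]) simp
      then show ?thesis using q by simp
    qed
    moreover have "1 - p * p ^ j = 1 - q ^ (5 * j + 5)" for j
      by (simp add: p_def power_add power2_eq_square flip: power_mult)
    ultimately show ?thesis
      unfolding qpoch_def prod.distrib by simp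
  qed
  ultimately show ?thesis by simp
qed

text \<open>The condition copies the one in the theorem, so that the product there folds to
  \<open>prodinf (rr_factor q)\<close>.\<close>

definition rr_factor :: "complex \<Rightarrow> nat \<Rightarrow> complex" where
  "rr_factor q m = (if m \<ge> 1 \<and> \<not> [int m = 0] (mod 5) \<and> \<not> [int m = 2] (mod 5) \<and> \<not> [int m = - 2] (mod 5)
            then 1 / (1 - q ^ m) else 1)"

lemma rr_factor_mod_5:
  "rr_factor q m = (if m mod 5 = 1 \<or> m mod 5 = 4 then 1 / (1 - q ^ m) else 1)"
proof -
  have "m mod 5 \<in> {0, 1, 2, 3, 4}" using mod_less_divisor[of 5 m] by auto
  moreover have "int m mod 5 = int (m mod 5)" by (simp add: zmod_int)
  ultimately show ?thesis
    by (cases "m = 0") (auto simp: rr_factor_def cong_def)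
qed

lemma convergent_prod_rr_factor:
  assumes "norm q < 1"
  shows "convergent_prod (rr_factor q)"
proof -
  \<comment> \<open>The reciprocals are 1 - q^m or 1, hence within |q|^m of 1, which avoids
    estimating 1/(1 - q^m).\<close>
  let ?g = "\<lambda>m. inverse (rr_factor q m)"
  have "summable (\<lambda>m. norm (?g m - 1))"
  proof (rule summable_comparison_test')
    show "summable (\<lambda>k. norm q ^ k)"
      using assms(1) by (intro summable_geometric) auto
    show "norm (norm (?g m - 1)) \<le> norm q ^ m" for m
      by (simp add: rr_factor_def norm_power)
  qed
  then have "convergent_prod ?g"
    by (intro abs_convergent_prod_imp_convergent_prod summable_imp_abs_convergent_prod)
  then have "convergent_prod (\<lambda>m. inverse (?g m))"
    by (rule convergent_prod_inverse)
  then show ?thesis by simp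
qed

text \<open>In each block of exponents 5j+1, ..., 5j+5 of (q;q)_(5n), the factors with residues 1
  and 4 cancel, leaving 5j+2, 5j+3 and 5j+5.\<close>

lemma rr_factor_partial_prod:
  assumes q: "norm q < 1"
  shows "(\<Prod>m\<le>5*n. rr_factor q m) * qpoch q q (5 * n) =
    (\<Prod>j<n. (1 - q ^ (5 * j + 2)) * (1 - q ^ (5 * j + 3)) * (1 - q ^ (5 * j + 5)))"
proof (induction n)
  case 0
  then show ?case by (simp add: rr_factor_def qpoch_def)
next
  case (Suc n)
  have e: "5 * Suc n = Suc (Suc (Suc (Suc (Suc (5 * n)))))" by simp
  have rr: "rr_factor q (Suc (5 * n)) = 1 / (1 - q ^ Suc (5 * n))"
    "rr_factor q (Suc (Suc (5 * n))) = 1"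
    "rr_factor q (Suc (Suc (Suc (5 * n)))) = 1"
    "rr_factor q (Suc (Suc (Suc (Suc (5 * n))))) = 1 / (1 - q ^ Suc (Suc (Suc (Suc (5 * n)))))"
    "rr_factor q (Suc (Suc (Suc (Suc (Suc (5 * n)))))) = 1"
    unfolding rr_factor_mod_5 by (simp_all add: mod_Suc)
  have nz: "1 - q ^ Suc (5 * n) \<noteq> 0" "1 - q ^ Suc (Suc (Suc (Suc (5 * n)))) \<noteq> 0"
    by (intro one_minus_power_neq_0 q zero_less_Suc)+
  have ex: "5 * n + 2 = Suc (Suc (5 * n))" "5 * n + 3 = Suc (Suc (Suc (5 * n)))"
    "5 * n + 5 = Suc (Suc (Suc (Suc (Suc (5 * n)))))" by simp_all
  \<comment> \<open>X and Y are the two products up to 5n; a, ..., e are the factors 1 - q^i for i =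
    5n+1, ..., 5n+5.\<close>
  have alg: "X * (1 / a) * 1 * 1 * (1 / d) * 1 * (e * (d * (c * (b * (a * Y))))) = X * Y * (b * c * e)"
    if "a \<noteq> 0" "d \<noteq> 0" for X Y a b c d e :: complex
    using that by simp
  show ?case
    unfolding e prod.atMost_Suc qpoch_Suc rr prod.lessThan_Suc Suc.IH[symmetric] ex
    by (rule alg[OF nz])
qed

text \<open>The partial products up to 5n have two limits, one from
  \<open>theta_product_limit\<close> and one from the convergence of both infinite products.
  Equating them and cancelling (q;q)_inf gives the identity.\<close>

lemma rogers_ramanujan:
  fixes q :: complex
  assumes q: "norm q < 1" "q \<noteq> 0"
  shows "(\<Sum>k. q ^ k\<^sup>2 * qfac_inv q (int k)) = prodinf (rr_factor q)"
proof -
  have sub: "filterlim (\<lambda>n::nat. 5 * n) at_top sequentially"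
    by (rule filterlim_subseq) (simp add: strict_mono_def)
  have "(\<lambda>n. (\<Prod>m\<le>5*n. rr_factor q m) * qpoch q q (5 * n)) \<longlonglongrightarrow> prodinf (rr_factor q) * qpoch_inf q q"
    by (intro tendsto_mult filterlim_compose[OF convergent_prod_LIMSEQ[OF convergent_prod_rr_factor] sub]
        filterlim_compose[OF qpoch_tendsto sub] q)
  then have "suminf (fold_symmetric (theta_coeff q)) = prodinf (rr_factor q) * qpoch_inf q q"
    unfolding rr_factor_partial_prod[OF q(1)] using theta_product_limit[OF q] LIMSEQ_unique by blast
  then show ?thesis
    unfolding rogers_ramanujan_theta[OF q] using qpoch_inf_neq_0[OF q(1)] by simp
qed

section \<open>Summation of the double series\<close>

lemma summable_on_geometric_pairs:
  fixes x :: real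
  assumes "0 \<le> x" "x < 1"
  shows "(\<lambda>(n, l). C * (x ^ n * x ^ l)) summable_on (UNIV :: (nat \<times> nat) set)"
proof -
  have s: "(\<lambda>l. x ^ l) sums (1 / (1 - x))"
    using assms by (intro geometric_sums) auto
  have "(\<lambda>z. case z of (n, l) \<Rightarrow> x ^ n * x ^ l) summable_on (Sigma (UNIV :: nat set) (\<lambda>_. UNIV :: nat set))"
  proof (rule summable_on_SigmaI[where g = "\<lambda>n. x ^ n * (1 / (1 - x))"])
    show "((\<lambda>l. case (n, l) of (n, l) \<Rightarrow> x ^ n * x ^ l) has_sum x ^ n * (1 / (1 - x))) UNIV" for n
      using sums_mult[OF s, of "x ^ n"] assms by (intro sums_nonneg_imp_has_sum) auto
    show "(\<lambda>n. x ^ n * (1 / (1 - x))) summable_on UNIV"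
      by (intro summable_nonneg_imp_summable_on sums_summable[OF sums_mult2[OF s]]) (use assms in auto)
  qed (use assms in auto)
  from summable_on_cmult_right[OF this, of C] show ?thesis
    by (simp add: case_prod_unfold)
qed

theorem mainTheorem11:
  fixes q :: complex
  assumes "norm q < 1"
  shows "((\<lambda>(n, l). q ^ (n\<^sup>2 + l\<^sup>2 + n * l) / (qpoch q q (n + l) * qpoch q q n * qpoch q q l))
      has_sum
        (1 / qpoch_inf q q *
          (\<Prod>m. if m \<ge> 1 \<and> \<not> [int m = 0] (mod 5) \<and> \<not> [int m = 2] (mod 5) \<and> \<not> [int m = - 2] (mod 5)
            then 1 / (1 - q ^ m) else 1))) (UNIV :: (nat \<times> nat) set)"
proof (cases "q = 0")
  case True
  \<comment> \<open>The preceding identities use integer powers of q and assume q nonzero. At q = 0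
    only the term (0, 0) survives and both products equal 1.\<close>
  have "qpoch_inf q q = 1" using True by (simp add: qpoch_inf_def)
  moreover have "rr_factor q = (\<lambda>_. 1)" using True by (auto simp: rr_factor_def fun_eq_iff power_0_left)
  then have "prodinf (rr_factor q) = 1" by simp
  ultimately show ?thesis
    unfolding rr_factor_def[symmetric]
    by (intro has_sum_finite_neutralI[where B = "{(0, 0)}"]) (auto simp: True qpoch_def power_0_left split: if_splits)
next
  case False
  note q = assms False
  let ?F = "\<lambda>(n, l). q ^ (n\<^sup>2 + l\<^sup>2 + n * l) / (qpoch q q (n + l) * qpoch q q n * qpoch q q l)"
  let ?f = "\<lambda>k. q ^ k\<^sup>2 * qfac_inv q (int k)"
  let ?h = "\<lambda>n l. q ^ (l * (l + n)) * (qfac_inv q (int l) * qfac_inv q (int l + int n))"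
  obtain C where C: "C > 0" "\<And>m. norm (qfac_inv q m) \<le> C"
    using qfac_inv_bounded[OF q(1)] by blast
  \<comment> \<open>Since n^2 + l^2 + nl = n^2 + l(l + n), each term is a Rogers-Ramanujan term
    times a Durfee rectangle term.\<close>
  have F: "?F (n, l) = ?f n * ?h n l" for n l
  proof -
    have e: "n\<^sup>2 + l\<^sup>2 + n * l = n\<^sup>2 + l * (l + n)" "int l + int n = int (n + l)"
      by (simp_all add: power2_eq_square algebra_simps)
    show ?thesis
      unfolding case_prod_conv e qfac_inv_of_nat power_add[of q "n\<^sup>2"] by simp
  qed
  have sq: "k \<le> k\<^sup>2" for k :: nat by (simp add: power2_nat_le_imp_le)
  have "summable (\<lambda>k. norm (?f k))"
    by (rule summable_norm_power_mono[OF q(1) _ C(2)]) (rule sq)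
  then have "(?f has_sum suminf ?f) UNIV"
    by (intro norm_summable_imp_has_sum summable_sums[OF summable_norm_cancel])
  then have outer: "((\<lambda>n. ?f n * (1 / qpoch_inf q q)) has_sum (suminf ?f * (1 / qpoch_inf q q))) UNIV"
    by (rule has_sum_cmult_left)
  have inner: "((\<lambda>l. ?F (n, l)) has_sum (?f n * (1 / qpoch_inf q q))) UNIV" for n
    unfolding F
    by (rule has_sum_cmult_right[OF norm_summable_imp_has_sum[OF cauchy_durfee_rectangle[OF q]]])
  \<comment> \<open>Each reciprocal q-factorial is at most C in norm and n^2 + l^2 + nl >= n + l, so
    a double geometric series dominates. This justifies summing over l first.\<close>
  have "?F summable_on UNIV"
  proof (rule abs_summable_summable, rule Infinite_Sum.abs_summable_on_comparison_test')
    show "(\<lambda>(n, l). C ^ 3 * (norm q ^ n * norm q ^ l)) summable_on (UNIV :: (nat \<times> nat) set)"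
      by (rule summable_on_geometric_pairs) (use q in auto)
    show "norm (?F z) \<le> (\<lambda>(n, l). C ^ 3 * (norm q ^ n * norm q ^ l)) z" for z
    proof (cases z)
      case (Pair n l)
      have "?F (n, l) = (qfac_inv q (int (n + l)) * qfac_inv q (int n) * qfac_inv q (int l)) * q ^ (n\<^sup>2 + l\<^sup>2 + n * l)"
        by (simp del: of_nat_add)
      then have "norm (?F (n, l)) = (norm (qfac_inv q (int (n + l))) * norm (qfac_inv q (int n)) * norm (qfac_inv q (int l)))
          * norm q ^ (n\<^sup>2 + l\<^sup>2 + n * l)"
        by (simp only: norm_mult norm_power)
      also have "\<dots> \<le> (C * C * C) * norm q ^ (n + l)"
      proof (intro mult_mono C power_decreasing)
        show "n + l \<le> n\<^sup>2 + l\<^sup>2 + n * l" using sq[of n] sq[of l] by linarith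
      qed (use C q in \<open>auto intro: less_imp_le\<close>)
      finally show ?thesis using Pair by (simp add: power_add power3_eq_cube)
    qed
  qed
  then have "?F summable_on (UNIV \<times> UNIV)" by simp
  then have "(?F has_sum (suminf ?f * (1 / qpoch_inf q q))) (UNIV \<times> UNIV)"
    by (rule has_sum_SigmaI[OF inner outer])
  then show ?thesis
    unfolding rr_factor_def[symmetric] rogers_ramanujan[OF q] by (simp add: mult.commute)
qed

end
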